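(* Let $\Theta\subseteq\mathbb{R}^m$, let $\mathcal{G}:\Theta\to\mathbb{R}^n$ be a measurable map with range $\mathcal{R}=\mathcal{G}(\Theta)$, let $\rho_y$ be a probability measure on $\mathbb{R}^n$, let $d$ be a metric on $\mathbb{R}^n$, and let $p\ge 1$. Assume that a solution to the problem $$\inf_{\rho_x\in\mathcal{P}(\Theta)}\mathcal{W}_p(\mathcal{G}_\#\rho_x,\rho_y)$$ exists. Then one of the minimizers takes the form $$\rho_x^*=\mathcal{F}_\#\rho_y,$$ and the reconstruction recovers the projection: $$\mathcal{G}_\#\rho_x^*=(\mathcal{P}_{\mathcal{G}})_\#\rho_y,$$ where $\mathcal{F}$ is the inversion map and $\mathcal{P}_{\mathcal{G}}$ the associated projection map.
   Context: $\mathcal{P}(\Theta)$ denotes the set of all probability measures on $\Theta$, and $\#$ denotes pushforward. The $p$-Wasserstein distance is $\mathcal{W}_p(\mu,\nu)=\left(\min_{\gamma\in\Gamma(\mu,\nu)}\int d^p(x,y)\,\mathrm{d}\gamma\right)^{1/p}$, where $\Gamma(\mu,\nu)$ is the set of all couplings of $\mu$ and $\nu$. The inversion map $\mathcal{F}:\mathbb{R}^n\to\Theta$ is $\mathcal{F}(y^* )=\operatorname{arg\,min}_{x\in\Theta}d(\mathcal{G}(x),y^* )$, and the projection map is $\mathcal{P}_{\mathcal{G}}(y^* )=\operatorname{arg\,min}_{y\in\mathcal{R}}d(y,y^* )=\mathcal{G}(\mathcal{F}(y^* ))$. It is assumed that these minimizers exist; if the minimizer is not unique, one is free to select one (so $\mathcal{F}$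 is a fixed, measurable, selection of minimizers and $\mathcal{P}_{\mathcal{G}}=\mathcal{G}\circ\mathcal{F}$). *)

theory Defs
  imports "HOL-Probability.Probability"
begin

text \<open>
  The set of all probability measures on a topological space, or on a subset of one equipped with
  the trace of the Borel sigma-algebra.
\<close>

definition prob_measures :: "'a::topological_space set \<Rightarrow> 'a measure set" where
  "prob_measures \<Theta> = space (prob_algebra (restrict_space borel \<Theta>))"

definition couplings :: "'a measure \<Rightarrow> 'b measure \<Rightarrow> ('a \<times> 'b) measure set" where
  "couplings \<mu> \<nu> =
     {\<gamma> \<in> space (prob_algebra (\<mu> \<Otimes>\<^sub>M \<nu>)). distr \<gamma> \<mu> fst = \<mu> \<and> distr \<gamma> \<nu> snd = \<nu>}"

text \<open>The case distinction is needed because \<^term>\<open>enn2real\<close> maps infinity to zero.\<close>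

definition ennreal_root :: "real \<Rightarrow> ennreal \<Rightarrow> ennreal" where
  "ennreal_root p x = (if x = \<infinity> then \<infinity> else ennreal (enn2real x powr (1 / p)))"

text \<open>
  The infimum over all couplings equals the minimum whenever the latter is attained; for a metric
  that is merely measurable it need not be. The value may be infinite, as no moments are assumed.
\<close>

definition wasserstein ::
  "real \<Rightarrow> ('a \<Rightarrow> 'a \<Rightarrow> real) \<Rightarrow> 'a measure \<Rightarrow> 'a measure \<Rightarrow> ennreal" where
  "wasserstein p d \<mu> \<nu> =
     ennreal_root p (INF \<gamma> \<in> couplings \<mu> \<nu>. \<integral>\<^sup>+ (x, y). ennreal (d x y powr p) \<partial>\<gamma>)"

text \<open>
  Minimizers need not be unique, so ``being an inversion map'' is a property of a selection \<open>F\<close>.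
  Measurability of \<open>F\<close> includes that it takes values in \<open>\<Theta>\<close>.
\<close>

definition inversion_map ::
  "('b \<Rightarrow> 'b \<Rightarrow> real) \<Rightarrow> 'a set \<Rightarrow> ('a \<Rightarrow> 'b) \<Rightarrow>
   ('b::topological_space \<Rightarrow> 'a::topological_space) \<Rightarrow> bool" where
  "inversion_map d \<Theta> G F \<longleftrightarrow>
     F \<in> borel \<rightarrow>\<^sub>M restrict_space borel \<Theta> \<and>
     (\<forall>y. is_arg_min (\<lambda>x. d (G x) y) (\<lambda>x. x \<in> \<Theta>) (F y))"

definition projection_map :: "('a \<Rightarrow> 'b) \<Rightarrow> ('b \<Rightarrow> 'a) \<Rightarrow> 'b \<Rightarrow> 'b" where
  "projection_map G F = G \<circ> F"

lemma is_arg_min_projection_map: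
  assumes "inversion_map d \<Theta> G F"
  shows "is_arg_min (\<lambda>z. d z y) (\<lambda>z. z \<in> G ` \<Theta>) (projection_map G F y)"
  using assms by (auto simp: inversion_map_def projection_map_def is_arg_min_def)

end

theory Submission
  imports Defs
begin

text \<open>
  The cost \<open>C = \<integral> d (P y) y powr p \<partial>\<rho>\<^sub>y\<close> of moving each \<open>y\<close> to its projection
  \<open>P y = projection_map G F y\<close> is sandwiched between the two Wasserstein distances to be compared.

  On the one hand, the law of \<open>(P y, y)\<close> couples the push-forward of \<open>\<rho>\<^sub>y\<close> under \<open>P\<close> with \<open>\<rho>\<^sub>y\<close>, so
  the \<open>p\<close>-th root of \<open>C\<close> bounds their distance from above (\<open>wasserstein_distr_le\<close>). As \<open>P = G \<circ> F\<close>,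
  that push-forward is also the image under \<open>G\<close> of the candidate minimizer.

  On the other hand, let \<open>\<rho>\<close> be any probability measure on \<open>\<Theta>\<close>, and couple its image under \<open>G\<close>
  with \<open>\<rho>\<^sub>y\<close>. The first coordinate \<open>x\<close> of the coupling lies in the range of \<open>G\<close>, so
  \<open>d (P y) y \<le> d x y\<close> because \<open>P y\<close> is a closest point of the range. Integrating shows that the
  coupling costs at least \<open>C\<close> (\<open>projection_cost_le_coupling_cost\<close>).

  The delicate point is the words ``lies in the range'': \<open>G ` \<Theta>\<close> is in general not Borel, and an
  image measure is concentrated on it only in the sense that Borel sets disjoint from it are null.
  Inner regularity of finite Borel measures on Polish spaces is what turns this into a statement
  that holds almost everywhere for the coupling (\<open>projection_cost_le_AE\<close>).
\<close>

lemma ennreal_root_mono: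
  assumes "0 \<le> p" "x \<le> y"
  shows "ennreal_root p x \<le> ennreal_root p y"
  using assms
  by (auto simp: ennreal_root_def top_unique less_top intro!: ennreal_leI powr_mono2 enn2real_mono)

text \<open>
  The first coordinates of a Borel set form an analytic set, which may fail to be Borel; those of a
  compact set are compact. Inner regularity therefore lets one argue with compact sets of first
  coordinates only, instead of with analytic sets or a disintegration of the measure.
\<close>

lemma null_if_compact_fst_null:
  fixes \<gamma> :: "('a::polish_space \<times> 'b::polish_space) measure"
  assumes sets: "sets \<gamma> = sets borel" and "finite_measure \<gamma>" and A: "A \<in> sets borel"
    and null: "\<And>K. compact K \<Longrightarrow> K \<subseteq> fst ` A \<Longrightarrow> emeasure \<gamma> (K \<times> UNIV) = 0"
  shows "emeasure \<gamma> A = 0"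
proof -
  interpret finite_measure \<gamma> by fact
  have space: "space \<gamma> = UNIV"
    using sets_eq_imp_space_eq[OF sets] by simp
  have "emeasure \<gamma> K = 0" if "compact K" "K \<subseteq> A" for K
  proof -
    have comp: "compact (fst ` K)"
      using that by (intro compact_continuous_image continuous_on_fst continuous_on_id)
    have "fst ` K \<times> (UNIV :: 'b set) \<in> sets borel"
      using compact_imp_closed[OF comp] by (intro borel_closed closed_Times closed_UNIV)
    then have "emeasure \<gamma> K \<le> emeasure \<gamma> (fst ` K \<times> UNIV)"
      by (intro emeasure_mono) (force simp: sets)+
    also have "\<dots> = 0"
      using that comp by (intro null) auto
    finally show ?thesis by simp
  qed
  then have "(SUP K\<in>{K. K \<subseteq> A \<and> compact K}. emeasure \<gamma> K) = 0"
    by (auto simp: SUP_eq_const SUP_eq_iff intro!: antisym SUP_least)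
  then show ?thesis
    using inner_regular[OF sets _ A] emeasure_finite[of UNIV] by (simp add: space)
qed

lemma couplingsD:
  assumes "\<gamma> \<in> couplings \<mu> \<nu>"
  shows "prob_space \<gamma>" "sets \<gamma> = sets (\<mu> \<Otimes>\<^sub>M \<nu>)" "distr \<gamma> \<mu> fst = \<mu>" "distr \<gamma> \<nu> snd = \<nu>"
  using assms by (auto simp: couplings_def space_prob_algebra)

lemma measurable_projection_map:
  assumes "inversion_map d \<Theta> G F" "G \<in> restrict_space borel \<Theta> \<rightarrow>\<^sub>M M"
  shows "projection_map G F \<in> borel \<rightarrow>\<^sub>M M"
  using assms by (auto simp: inversion_map_def projection_map_def intro: measurable_comp)

text \<open>
  The pointwise inequality holds for every \<open>x\<close> in the range \<open>G ` \<Theta>\<close>, since \<open>projection_map G F y\<close>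
  is a closest point of that range. The range need not be Borel, so it cannot serve directly as a
  set of full measure. But every compact set of exceptional first coordinates is disjoint from it,
  hence has an empty preimage under \<open>G\<close> in \<open>\<Theta>\<close>, and \<open>null_if_compact_fst_null\<close> applies.
\<close>

lemma projection_cost_le_AE:
  fixes \<nu> :: "'b::polish_space measure" and \<Theta> :: "'a::topological_space set"
  assumes G: "G \<in> restrict_space borel \<Theta> \<rightarrow>\<^sub>M borel"
    and d: "(\<lambda>(y, y'). d y y') \<in> borel \<Otimes>\<^sub>M borel \<rightarrow>\<^sub>M borel"
    and F: "inversion_map d \<Theta> G F"
    and \<rho>: "\<rho> \<in> prob_measures \<Theta>" and \<nu>: "sets \<nu> = sets borel"
    and \<gamma>: "\<gamma> \<in> couplings (distr \<rho> borel G) \<nu>"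
  shows "AE (x, y) in \<gamma>. d (projection_map G F y) y \<le> d x y"
proof -
  interpret prob_space \<gamma> using couplingsD(1)[OF \<gamma>] .
  let ?P = "projection_map G F"
  define A where "A = {(x, y). d x y < d (?P y) y}"
  have sets_pair: "sets \<gamma> = sets (borel \<Otimes>\<^sub>M borel)"
    unfolding couplingsD(2)[OF \<gamma>] using \<nu> by (intro sets_pair_measure_cong) auto
  then have sets: "sets \<gamma> = sets borel"
    by (simp only: borel_prod)
  have space: "space \<gamma> = UNIV"
    using sets_eq_imp_space_eq[OF sets] by simp
  have P [measurable]: "?P \<in> borel \<rightarrow>\<^sub>M borel"
    using F G by (rule measurable_projection_map)
  note d [measurable]
  have "A = {z \<in> space (borel \<Otimes>\<^sub>M borel).
      (\<lambda>(y, y'). d y y') z < (\<lambda>(y, y'). d y y') (?P (snd z), snd z)}"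
    by (auto simp: A_def space_pair_measure)
  also have "\<dots> \<in> sets (borel \<Otimes>\<^sub>M borel)"
    by measurable
  finally have A: "A \<in> sets borel"
    by (simp only: borel_prod)
  have disjoint: "G x \<notin> fst ` A" if "x \<in> \<Theta>" for x
    using is_arg_min_projection_map[OF F] that by (force simp: A_def is_arg_min_def)
  have "emeasure \<gamma> A = 0"
  proof (rule null_if_compact_fst_null[OF sets finite_measure_axioms A])
    fix K assume K: "compact K" "K \<subseteq> fst ` A"
    have K_sets: "K \<in> sets borel"
      using K(1) by (intro borel_closed compact_imp_closed)
    have \<rho>_sets: "sets \<rho> = sets (restrict_space borel \<Theta>)"
      using \<rho> by (simp add: prob_measures_def space_prob_algebra)
    then have \<rho>_space: "space \<rho> = \<Theta>"
      using sets_eq_imp_space_eq[OF \<rho>_sets] by (simp add: space_restrict_space)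
    have G': "G \<in> \<rho> \<rightarrow>\<^sub>M borel"
      using G measurable_cong_sets[OF \<rho>_sets refl] by blast
    have "fst \<in> \<gamma> \<rightarrow>\<^sub>M distr \<rho> borel G"
      unfolding measurable_cong_sets[OF sets_pair sets_distr] by simp
    then have "emeasure \<gamma> (K \<times> UNIV) = emeasure (distr \<gamma> (distr \<rho> borel G) fst) K"
      using K_sets by (subst emeasure_distr) (auto simp: space intro!: arg_cong[where f = "emeasure \<gamma>"])
    also have "\<dots> = emeasure \<rho> (G -` K \<inter> space \<rho>)"
      unfolding couplingsD(3)[OF \<gamma>] using G' K_sets by (rule emeasure_distr)
    also have "G -` K \<inter> space \<rho> = {}"
      using K(2) disjoint by (auto simp: \<rho>_space)
    finally show "emeasure \<gamma> (K \<times> UNIV) = 0" by simp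
  qed
  then show ?thesis
    using A by (intro AE_I[of _ _ A]) (auto simp: A_def sets)
qed

text \<open>
  The left-hand side depends on \<open>y\<close> only, so it may be computed under any coupling, and there it is
  dominated almost everywhere by the cost of the coupling.
\<close>

lemma projection_cost_le_coupling_cost:
  fixes \<nu> :: "'b::polish_space measure" and \<Theta> :: "'a::topological_space set"
  assumes G: "G \<in> restrict_space borel \<Theta> \<rightarrow>\<^sub>M borel"
    and d: "(\<lambda>(y, y'). d y y') \<in> borel \<Otimes>\<^sub>M borel \<rightarrow>\<^sub>M borel"
    and nonneg: "\<And>y y'. 0 \<le> d y y'" and p: "0 \<le> p"
    and F: "inversion_map d \<Theta> G F"
    and \<rho>: "\<rho> \<in> prob_measures \<Theta>" and \<nu>: "sets \<nu> = sets borel"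
    and \<gamma>: "\<gamma> \<in> couplings (distr \<rho> borel G) \<nu>"
  shows "(\<integral>\<^sup>+ y. ennreal (d (projection_map G F y) y powr p) \<partial>\<nu>)
    \<le> (\<integral>\<^sup>+ (x, y). ennreal (d x y powr p) \<partial>\<gamma>)"
proof -
  let ?P = "projection_map G F"
  have P [measurable]: "?P \<in> borel \<rightarrow>\<^sub>M borel"
    using F G by (rule measurable_projection_map)
  have [measurable]: "(\<lambda>y. d (?P y) y) \<in> borel \<rightarrow>\<^sub>M borel"
    using measurable_compose[OF _ d, of "\<lambda>y. (?P y, y)" borel] by simp
  have cost: "(\<lambda>y. ennreal (d (?P y) y powr p)) \<in> \<nu> \<rightarrow>\<^sub>M borel"
    unfolding measurable_cong_sets[OF \<nu> refl] by measurable
  have snd: "snd \<in> \<gamma> \<rightarrow>\<^sub>M \<nu>"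
    unfolding measurable_cong_sets[OF couplingsD(2)[OF \<gamma>] refl] by simp
  have "(\<integral>\<^sup>+ y. ennreal (d (?P y) y powr p) \<partial>\<nu>)
      = (\<integral>\<^sup>+ y. ennreal (d (?P y) y powr p) \<partial>distr \<gamma> \<nu> snd)"
    by (simp only: couplingsD(4)[OF \<gamma>])
  also have "\<dots> = (\<integral>\<^sup>+ z. ennreal (d (?P (snd z)) (snd z) powr p) \<partial>\<gamma>)"
    using snd cost by (simp add: nn_integral_distr)
  also have "\<dots> \<le> (\<integral>\<^sup>+ (x, y). ennreal (d x y powr p) \<partial>\<gamma>)"
    using projection_cost_le_AE[OF G d F \<rho> \<nu> \<gamma>]
    by (intro nn_integral_mono_AE)
      (auto elim!: eventually_mono intro!: ennreal_leI powr_mono2 p nonneg)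
  finally show ?thesis .
qed

text \<open>The deterministic plan that a map \<open>T\<close> induces, read with the image of \<open>T\<close> as first factor.\<close>

lemma graph_coupling:
  assumes "prob_space \<nu>" and T: "T \<in> \<nu> \<rightarrow>\<^sub>M M"
  shows "distr \<nu> (M \<Otimes>\<^sub>M \<nu>) (\<lambda>y. (T y, y)) \<in> couplings (distr \<nu> M T) \<nu>"
proof -
  interpret prob_space \<nu> by fact
  note T [measurable]
  have sets: "sets (M \<Otimes>\<^sub>M \<nu>) = sets (distr \<nu> M T \<Otimes>\<^sub>M \<nu>)"
    by (intro sets_pair_measure_cong) auto
  have "distr (distr \<nu> (M \<Otimes>\<^sub>M \<nu>) (\<lambda>y. (T y, y))) (distr \<nu> M T) fst = distr \<nu> M T"
    by (subst distr_distr) (auto simp: comp_def intro!: distr_cong)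
  moreover have "distr (distr \<nu> (M \<Otimes>\<^sub>M \<nu>) (\<lambda>y. (T y, y))) \<nu> snd = \<nu>"
    by (subst distr_distr) (auto simp: comp_def)
  ultimately show ?thesis
    by (auto simp: couplings_def space_prob_algebra sets[symmetric] intro!: prob_space_distr)
qed

lemma wasserstein_distr_le:
  fixes \<nu> :: "'b::topological_space measure"
  assumes "prob_space \<nu>" and \<nu>: "sets \<nu> = sets borel" and T: "T \<in> borel \<rightarrow>\<^sub>M borel"
    and d: "(\<lambda>(y, y'). d y y') \<in> borel \<Otimes>\<^sub>M borel \<rightarrow>\<^sub>M borel" and p: "0 \<le> p"
  shows "wasserstein p d (distr \<nu> borel T) \<nu>
    \<le> ennreal_root p (\<integral>\<^sup>+ y. ennreal (d (T y) y powr p) \<partial>\<nu>)"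
proof -
  have T': "T \<in> \<nu> \<rightarrow>\<^sub>M borel"
    using T unfolding measurable_cong_sets[OF \<nu> refl] .
  have sets: "sets (borel \<Otimes>\<^sub>M \<nu>) = sets (borel \<Otimes>\<^sub>M borel)"
    using \<nu> by (intro sets_pair_measure_cong) auto
  have d': "(\<lambda>(y, y'). d y y') \<in> borel \<Otimes>\<^sub>M \<nu> \<rightarrow>\<^sub>M borel"
    using d unfolding measurable_cong_sets[OF sets refl] .
  note T' [measurable] d' [measurable]
  have "(INF \<gamma> \<in> couplings (distr \<nu> borel T) \<nu>. \<integral>\<^sup>+ (x, y). ennreal (d x y powr p) \<partial>\<gamma>)
      \<le> (\<integral>\<^sup>+ (x, y). ennreal (d x y powr p) \<partial>distr \<nu> (borel \<Otimes>\<^sub>M \<nu>) (\<lambda>y. (T y, y)))"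
    using graph_coupling[OF assms(1) T'] by (rule INF_lower)
  also have "\<dots> = (\<integral>\<^sup>+ y. ennreal (d (T y) y powr p) \<partial>\<nu>)"
    by (subst nn_integral_distr) auto
  finally show ?thesis
    unfolding wasserstein_def by (intro ennreal_root_mono p)
qed

theorem theorem2p4:
  fixes \<Theta> :: "(real ^ 'm) set"
    and G :: "real ^ 'm \<Rightarrow> real ^ 'n"
    and \<rho>\<^sub>y :: "(real ^ 'n) measure"
    and d :: "real ^ 'n \<Rightarrow> real ^ 'n \<Rightarrow> real"
    and p :: real
    and F :: "real ^ 'n \<Rightarrow> real ^ 'm"
  assumes G: "G \<in> restrict_space borel \<Theta> \<rightarrow>\<^sub>M borel"
    and \<rho>\<^sub>y: "\<rho>\<^sub>y \<in> prob_measures UNIV"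
    and d_metric: "Metric_space UNIV d"
    and d_measurable: "(\<lambda>(y, y'). d y y') \<in> borel \<Otimes>\<^sub>M borel \<rightarrow>\<^sub>M borel"
    and p: "p \<ge> 1"
    and solution_exists:
      "\<exists>\<rho>. is_arg_min (\<lambda>\<rho>\<^sub>x. wasserstein p d (distr \<rho>\<^sub>x borel G) \<rho>\<^sub>y)
             (\<lambda>\<rho>\<^sub>x. \<rho>\<^sub>x \<in> prob_measures \<Theta>) \<rho>"
    and F: "inversion_map d \<Theta> G F"
  shows "is_arg_min (\<lambda>\<rho>\<^sub>x. wasserstein p d (distr \<rho>\<^sub>x borel G) \<rho>\<^sub>y)
           (\<lambda>\<rho>\<^sub>x. \<rho>\<^sub>x \<in> prob_measures \<Theta>)
           (distr \<rho>\<^sub>y (restrict_space borel \<Theta>) F) \<and>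
         distr (distr \<rho>\<^sub>y (restrict_space borel \<Theta>) F) borel G =
           distr \<rho>\<^sub>y borel (projection_map G F)"
proof -
  let ?P = "projection_map G F"
  let ?\<rho> = "distr \<rho>\<^sub>y (restrict_space borel \<Theta>) F"
  have prob: "prob_space \<rho>\<^sub>y" and sets: "sets \<rho>\<^sub>y = sets borel"
    using \<rho>\<^sub>y by (auto simp: prob_measures_def space_prob_algebra)
  have F_borel: "F \<in> borel \<rightarrow>\<^sub>M restrict_space borel \<Theta>"
    using F by (simp add: inversion_map_def)
  then have F_meas: "F \<in> \<rho>\<^sub>y \<rightarrow>\<^sub>M restrict_space borel \<Theta>"
    unfolding measurable_cong_sets[OF sets refl] .
  have P: "?P \<in> borel \<rightarrow>\<^sub>M borel"
    using F G by (rule measurable_projection_map)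
  have nonneg: "0 \<le> d y y'" for y y'
    using d_metric by (rule Metric_space.nonneg)
  have p0: "0 \<le> p" using p by simp
  have push: "distr ?\<rho> borel G = distr \<rho>\<^sub>y borel ?P"
    unfolding projection_map_def using G F_meas by (rule distr_distr)
  have "?\<rho> \<in> prob_measures \<Theta>"
    using prob_space.prob_space_distr[OF prob F_meas]
    by (simp add: prob_measures_def space_prob_algebra)
  moreover have "wasserstein p d (distr ?\<rho> borel G) \<rho>\<^sub>y \<le> wasserstein p d (distr \<rho> borel G) \<rho>\<^sub>y"
    if "\<rho> \<in> prob_measures \<Theta>" for \<rho>
  proof -
    have "wasserstein p d (distr ?\<rho> borel G) \<rho>\<^sub>y
        \<le> ennreal_root p (\<integral>\<^sup>+ y. ennreal (d (?P y) y powr p) \<partial>\<rho>\<^sub>y)"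
      unfolding push by (rule wasserstein_distr_le[OF prob sets P d_measurable p0])
    also have "\<dots> \<le> wasserstein p d (distr \<rho> borel G) \<rho>\<^sub>y"
      unfolding wasserstein_def
      by (intro ennreal_root_mono p0 INF_greatest
          projection_cost_le_coupling_cost[OF G d_measurable nonneg p0 F that sets])
    finally show ?thesis .
  qed
  ultimately show ?thesis
    using push by (auto simp: is_arg_min_def not_less)
qed

end
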